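(* Let $m\ge1$, let $\kappa_1,\kappa_2>m/2-1$, and let $\Lambda$ be an $m\times m$ Hermitian matrix. For every partition $\tau=(\tau_1,\dots,\tau_m)$, $$P_\tau^{(\kappa_1,\kappa_2,2)}(\Lambda)=\frac{\det\left(\left(\left(P_{\tau_\ell+m-\ell}^{(\kappa_1-m/2,\kappa_2-m/2)}(\Lambda)\right)_{jj}\right)_{1\le\ell,j\le m}\right)}{\det\left(\left((\Lambda^{m-\ell})_{jj}\right)_{1\le\ell,j\le m}\right)}$$ as an identity of rational functions in the coefficients of $\Lambda$ (in particular, for all $\Lambda$ for which the denominator is non-zero). Here $P_r^{(\alpha,\beta)}(\Lambda)$ is the one-variable polynomial $P_r^{(\alpha,\beta)}$ evaluated at the matrix $\Lambda$, and $(\cdot)_{jj}$ denotes the $j$-th diagonal entry of a matrix.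
   Context: A partition is $\tau=(\tau_1\ge\dots\ge\tau_m\ge0)\in\mathbb{N}^m$. The Hermitian Jacobi polynomials are, for $\Lambda$ Hermitian with eigenvalues $\lambda_1,\dots,\lambda_m$, $$P_\tau^{(\kappa_1,\kappa_2,2)}(\Lambda):=\frac{\det\left(\left(P^{(\kappa_1-m/2,\kappa_2-m/2)}_{\tau_\ell+m-\ell}(\lambda_j)\right)_{1\le\ell,j\le m}\right)}{\prod_{1\le\ell<j\le m}(\lambda_\ell-\lambda_j)},$$ (a symmetric polynomial in the eigenvalues, hence a polynomial in the coefficients of $\Lambda$ invariant under conjugation by unitary matrices), where $P_r^{(\alpha,\beta)}$ is the $r$-th Jacobi polynomial of index $(\alpha,\beta)$ on $[0,1]$, i.e. the degree $r$ orthogonal polynomial for the weight $x^\alpha(1-x)^\beta$ on $[0,1]$ (with any fixed normalisation). *)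

theory Defs
  imports
    "HOL-Analysis.Lebesgue_Measure"
    "HOL-Analysis.Set_Integral"
    "HOL-Library.Poly_Mapping"
    "HOL-Library.Nat_Bijection"
    "HOL-Computational_Algebra.Polynomial_Factorial"
    "Jordan_Normal_Form.Schur_Decomposition"
begin

section \<open>Jacobi polynomials on the unit interval\<close>

text \<open>The normalisation is left free: \<open>jacobi_poly \<alpha> \<beta> r\<close> holds for every nonzero scalar
  multiple of the Jacobi polynomial of degree \<open>r\<close> and index \<open>(\<alpha>, \<beta>)\<close>. It is meant for
  \<open>\<alpha>, \<beta> > -1\<close>, where the weight is integrable.\<close>

definition jacobi_poly :: "real \<Rightarrow> real \<Rightarrow> nat \<Rightarrow> real poly \<Rightarrow> bool" where
  "jacobi_poly \<alpha> \<beta> r p \<longleftrightarrow> p \<noteq> 0 \<and> degree p = r \<and>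
     (\<forall>q. degree q < r \<longrightarrow>
        (LINT x:{0..1}|lborel. poly p x * poly q x * (x powr \<alpha> * (1 - x) powr \<beta>)) = 0)"


section \<open>Matrices\<close>

definition hermitian_mat :: "complex mat \<Rightarrow> bool" where
  "hermitian_mat A \<longleftrightarrow> square_mat A \<and> mat_adjoint A = A"

definition poly_mat :: "'a :: comm_ring_1 poly \<Rightarrow> 'a mat \<Rightarrow> 'a mat" where
  "poly_mat p A = mat (dim_row A) (dim_row A)
     (\<lambda>(i, j). \<Sum>k\<le>degree p. coeff p k * (A ^\<^sub>m k) $$ (i, j))"

text \<open>The eigenvalues with multiplicity, in an unspecified order; they are only used as arguments of
  a symmetric polynomial.\<close>

definition eigenvalue_list :: "complex mat \<Rightarrow> complex list" where
  "eigenvalue_list A = (SOME es. char_poly A = (\<Prod>e\<leftarrow>es. [:- e, 1:]))"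


section \<open>Multivariate polynomials over the complex numbers\<close>

type_synonym cmpoly = "(nat \<Rightarrow>\<^sub>0 nat) \<Rightarrow>\<^sub>0 complex"

definition mvar :: "nat \<Rightarrow> cmpoly" where
  "mvar v = Poly_Mapping.single (Poly_Mapping.single v 1) 1"

definition mconst :: "complex \<Rightarrow> cmpoly" where
  "mconst c = Poly_Mapping.single 0 c"

definition meval :: "(nat \<Rightarrow> complex) \<Rightarrow> cmpoly \<Rightarrow> complex" where
  "meval x p = (\<Sum>u\<in>Poly_Mapping.keys p. Poly_Mapping.lookup p u *
     (\<Prod>v\<in>Poly_Mapping.keys u. x v ^ Poly_Mapping.lookup u v))"


section \<open>Hermitian Jacobi polynomials\<close>

definition is_partition :: "nat \<Rightarrow> nat list \<Rightarrow> bool" where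
  "is_partition m \<tau> \<longleftrightarrow> length \<tau> = m \<and> sorted_wrt (\<ge>) \<tau>"

text \<open>Rows and columns are numbered from \<open>0\<close>, so the degree \<open>\<tau>\<^sub>l + m - l\<close> of the row \<open>l \<in> {1..m}\<close>
  becomes \<open>\<tau> ! l + (m - Suc l)\<close> for \<open>l < m\<close>.

  The quotient of the determinant by the Vandermonde product is taken in the polynomial ring, in
  the variables \<open>\<lambda>\<^sub>0, \<dots>, \<lambda>\<^bsub>m-1\<^esub>\<close>. The division is exact because the determinant is alternating.
  Matrices with repeated eigenvalues are thereby covered.\<close>

definition sym_jacobi :: "nat \<Rightarrow> (nat \<Rightarrow> real poly) \<Rightarrow> nat list \<Rightarrow> cmpoly" where
  "sym_jacobi m P \<tau> = (THE S.
     S * (\<Prod>l<m. \<Prod>j\<in>{l<..<m}. mvar l - mvar j) =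
     det (mat m m (\<lambda>(l, j).
       poly (map_poly (\<lambda>c. mconst (complex_of_real c)) (P (\<tau> ! l + (m - Suc l)))) (mvar j))))"

definition hermitian_jacobi ::
  "nat \<Rightarrow> (nat \<Rightarrow> real poly) \<Rightarrow> nat list \<Rightarrow> complex mat \<Rightarrow> complex" where
  "hermitian_jacobi m P \<tau> \<Lambda> = meval (\<lambda>j. eigenvalue_list \<Lambda> ! j) (sym_jacobi m P \<tau>)"


section \<open>Rational functions in the coefficients of a matrix\<close>

text \<open>The coefficient in position \<open>(i, j)\<close> is the variable with number \<open>prod_encode (i, j)\<close>. The
  entries \<open>\<Lambda>\<^sub>i\<^sub>j\<close> of a Hermitian matrix, as complex valued functions on the real vector space of
  Hermitian matrices, are algebraically independent over the complex numbers, so the complex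
  polynomial functions of the coefficients of a Hermitian matrix are the polynomials in \<open>m\<^sup>2\<close>
  independent variables.\<close>

definition generic_mat :: "nat \<Rightarrow> cmpoly fract mat" where
  "generic_mat m = mat m m (\<lambda>(i, j). to_fract (mvar (prod_encode (i, j))))"

definition eval_coeffs :: "complex mat \<Rightarrow> cmpoly \<Rightarrow> complex" where
  "eval_coeffs \<Lambda> = meval (\<lambda>v. \<Lambda> $$ prod_decode v)"

definition fract_of_real :: "real \<Rightarrow> cmpoly fract" where
  "fract_of_real c = to_fract (mconst (complex_of_real c))"

end

theory Submission
  imports Defs
begin

text \<open>For monic \<open>c\<close> of degree \<open>m\<close>, write \<open>f\<^sub>l mod c = \<Sum>\<^sub>i C\<^sub>l\<^sub>i x\<^bsup>m-i\<^esup>\<close>. If \<open>c\<close> is the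
  characteristic polynomial of \<open>A\<close>, Cayley--Hamilton gives \<open>f\<^sub>l(A)\<^sub>j\<^sub>j = \<Sum>\<^sub>i C\<^sub>l\<^sub>i (A\<^bsup>m-i\<^esup>)\<^sub>j\<^sub>j\<close>, so the
  determinant in the numerator is \<open>det C\<close> times the one in the denominator. The same argument with
  \<open>c = \<Prod>\<^sub>j (x - \<lambda>\<^sub>j)\<close> and powers of \<open>\<lambda>\<^sub>j\<close> shows that the determinant of the \<open>f\<^sub>l(\<lambda>\<^sub>j)\<close> is \<open>det C\<close> times
  the Vandermonde product. Hence both quotients equal \<open>det C\<close>, which is a polynomial in the
  coefficients of \<open>c\<close> and therefore in the entries of \<open>A\<close>.\<close>

section \<open>Evaluation of multivariate polynomials as a ring homomorphism\<close>

lemma meval_superset: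
  assumes "finite K" "Poly_Mapping.keys p \<subseteq> K"
  shows "meval x p = (\<Sum>u\<in>K. Poly_Mapping.lookup p u *
    (\<Prod>v\<in>Poly_Mapping.keys u. x v ^ Poly_Mapping.lookup u v))"
  unfolding meval_def
  by (rule sum.mono_neutral_left) (use assms in \<open>auto simp: in_keys_iff\<close>)

lemma meval_add: "meval x (p + q) = meval x p + meval x q"
proof -
  let ?K = "Poly_Mapping.keys p \<union> Poly_Mapping.keys q"
  have "Poly_Mapping.keys (p + q) \<subseteq> ?K"
    by (rule Poly_Mapping.keys_add)
  then show ?thesis
    by (simp add: meval_superset[of ?K] lookup_add algebra_simps sum.distrib)
qed

lemma meval_single:
  "meval x (Poly_Mapping.single u c) =
    c * (\<Prod>v\<in>Poly_Mapping.keys u. x v ^ Poly_Mapping.lookup u v)"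
  by (subst meval_superset[of "{u}"]) auto

lemma meval_0 [simp]: "meval x 0 = 0"
  by (simp add: meval_def)

lemma meval_sum: "meval x (sum f I) = (\<Sum>i\<in>I. meval x (f i))"
  by (induction I rule: infinite_finite_induct) (auto simp: meval_add)

lemma poly_mapping_sum_single:
  fixes p :: "'a \<Rightarrow>\<^sub>0 'b::comm_monoid_add"
  shows "(\<Sum>u\<in>Poly_Mapping.keys p. Poly_Mapping.single u (Poly_Mapping.lookup p u)) = p"
  by (rule poly_mapping_eqI)
    (auto simp: lookup_sum lookup_single when_def sum.delta in_keys_iff)

lemma prod_keys_superset:
  fixes x :: "nat \<Rightarrow> complex"
  assumes "finite K" "Poly_Mapping.keys u \<subseteq> K"
  shows "(\<Prod>v\<in>Poly_Mapping.keys u. x v ^ Poly_Mapping.lookup u v) =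
    (\<Prod>v\<in>K. x v ^ Poly_Mapping.lookup u v)"
  by (rule prod.mono_neutral_left) (use assms in \<open>auto simp: in_keys_iff\<close>)

lemma prod_keys_add:
  fixes x :: "nat \<Rightarrow> complex"
  shows "(\<Prod>v\<in>Poly_Mapping.keys (u + w). x v ^ Poly_Mapping.lookup (u + w) v) =
    (\<Prod>v\<in>Poly_Mapping.keys u. x v ^ Poly_Mapping.lookup u v) *
    (\<Prod>v\<in>Poly_Mapping.keys w. x v ^ Poly_Mapping.lookup w v)"
proof -
  let ?K = "Poly_Mapping.keys u \<union> Poly_Mapping.keys w"
  have "Poly_Mapping.keys (u + w) \<subseteq> ?K"
    by (rule Poly_Mapping.keys_add)
  then show ?thesis
    using prod_keys_superset[of ?K "u + w" x] prod_keys_superset[of ?K u x]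
      prod_keys_superset[of ?K w x]
    by (simp add: lookup_add power_add prod.distrib)
qed

lemma meval_mult: "meval x (p * q) = meval x p * meval x q"
proof -
  \<comment> \<open>Both factors are split into monomials, so that multiplicativity reduces to
    \<open>prod_keys_add\<close>.\<close>
  have "meval x ((\<Sum>u\<in>Poly_Mapping.keys p. Poly_Mapping.single u (Poly_Mapping.lookup p u)) *
      (\<Sum>w\<in>Poly_Mapping.keys q. Poly_Mapping.single w (Poly_Mapping.lookup q w))) =
    meval x p * meval x q"
    unfolding sum_product meval_sum mult_single meval_single prod_keys_add
    by (simp add: meval_def sum_product algebra_simps)
  then show ?thesis
    by (simp add: poly_mapping_sum_single)
qed

lemma meval_mconst [simp]: "meval x (mconst c) = c"
  by (simp add: mconst_def meval_single)

lemma meval_mvar [simp]: "meval x (mvar v) = x v"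
  by (simp add: mvar_def meval_single)

lemma meval_1: "meval x 1 = 1"
  using meval_mconst[of x 1] by (simp add: mconst_def)

lemma comm_ring_hom_meval: "comm_ring_hom (meval x)"
  by unfold_locales (simp_all add: meval_add meval_mult meval_1)

lemma comm_ring_hom_to_fract: "comm_ring_hom to_fract"
  by unfold_locales simp_all

lemma mvar_eq_iff: "mvar u = mvar v \<longleftrightarrow> u = v"
proof
  assume "mvar u = mvar v"
  then have "meval (\<lambda>w. if w = u then 1 else 0) (mvar u) =
      meval (\<lambda>w. if w = u then 1 else 0) (mvar v)"
    by simp
  then show "u = v"
    by (simp split: if_splits)
qed simp

section \<open>Cayley-Hamilton over a commutative ring\<close>

text \<open>The shift \<open>k\<close> turns Cayley-Hamilton into a linear recurrence for each
  sequence of entries of powers of \<open>A\<close>, the form that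
  \<open>recurrence_power_rem\<close> takes as input.\<close>

lemma cayley_hamilton_entry:
  fixes A :: "'a::comm_ring_1 mat"
  assumes A: "A \<in> carrier_mat n n" and ac: "a < n" "c < n"
  shows "(\<Sum>i\<le>n. coeff (char_poly A) i * (A ^\<^sub>m (k + i)) $$ (a, c)) = 0"
proof -
  \<comment> \<open>Compare coefficients in \<open>(x - A) * adj (x - A) = char_poly A\<close>, where \<open>adj (x - A) = \<Sum>\<^sub>i D\<^sub>i x\<^sup>i\<close>,
    and multiply the \<open>i\<close>-th equation by \<open>A\<^bsup>k+i\<^esup>\<close>: the sum telescopes.\<close>
  define B where "B = adj_mat (char_poly_matrix A)"
  define D where "D i = mat n n (\<lambda>(a, c). coeff (B $$ (a, c)) i)" for i
  have C: "char_poly_matrix A \<in> carrier_mat n n" and B: "B \<in> carrier_mat n n"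
    using A adj_mat(1)[of "char_poly_matrix A" n] by (auto simp: B_def)
  have D: "D i \<in> carrier_mat n n" for i
    by (simp add: D_def)
  have pw: "A ^\<^sub>m i \<in> carrier_mat n n" for i
    using A by simp
  have CB: "char_poly_matrix A * B = char_poly A \<cdot>\<^sub>m 1\<^sub>m n"
    using adj_mat(2)[OF C] by (simp add: B_def char_poly_def)
  have entry: "(\<Sum>k<n. (if a = k then [:0, 1:] * B $$ (k, c) else 0) - smult (A $$ (a, k)) (B $$ (k, c)))
      = (if a = c then char_poly A else 0)" if "a < n" "c < n" for a c
  proof -
    have "(\<Sum>k<n. (if a = k then [:0, 1:] * B $$ (k, c) else 0) - smult (A $$ (a, k)) (B $$ (k, c)))
      = (char_poly_matrix A * B) $$ (a, c)"
      using that A B unfolding char_poly_matrix_def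
      by (auto simp: scalar_prod_def lessThan_atLeast0 intro!: sum.cong)
    then show ?thesis
      using that by (simp add: CB)
  qed
  have entry': "[:0, 1:] * B $$ (a, c) - (\<Sum>k<n. smult (A $$ (a, k)) (B $$ (k, c)))
      = (if a = c then char_poly A else 0)" if "a < n" "c < n" for a c
    using entry[OF that] that by (simp add: sum_subtractf)
  have AD: "(A * D i) $$ (a, c) = (\<Sum>k<n. A $$ (a, k) * coeff (B $$ (k, c)) i)"
    if "a < n" "c < n" for a c i
    using that A by (auto simp: D_def scalar_prod_def lessThan_atLeast0 intro!: sum.cong)
  have eq0: "coeff (char_poly A) 0 \<cdot>\<^sub>m 1\<^sub>m n = - (A * D 0)"
  proof (rule eq_matI)
    fix a c assume "a < dim_row (- (A * D 0))" "c < dim_col (- (A * D 0))"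
    then have ac: "a < n" "c < n" using A by (auto simp: D_def)
    show "(coeff (char_poly A) 0 \<cdot>\<^sub>m 1\<^sub>m n) $$ (a, c) = (- (A * D 0)) $$ (a, c)"
      using arg_cong[OF entry'[OF ac], of "\<lambda>p. coeff p 0"] ac A D[of 0]
      by (simp add: AD coeff_sum del: index_mult_mat(1) split: if_splits)
  qed (use A in \<open>auto simp: D_def\<close>)
  have eqS: "coeff (char_poly A) (Suc i) \<cdot>\<^sub>m 1\<^sub>m n = D i - A * D (Suc i)" for i
  proof (rule eq_matI)
    fix a c assume "a < dim_row (D i - A * D (Suc i))" "c < dim_col (D i - A * D (Suc i))"
    then have ac: "a < n" "c < n" using A by (auto simp: D_def)
    have Dac: "D i $$ (a, c) = coeff (B $$ (a, c)) i"
      using ac by (simp add: D_def)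
    show "(coeff (char_poly A) (Suc i) \<cdot>\<^sub>m 1\<^sub>m n) $$ (a, c) = (D i - A * D (Suc i)) $$ (a, c)"
      using arg_cong[OF entry'[OF ac], of "\<lambda>p. coeff p (Suc i)"] ac A D[of i] D[of "Suc i"]
      by (simp add: AD Dac coeff_sum del: index_mult_mat(1) split: if_splits)
  qed (use A in \<open>auto simp: D_def\<close>)
  have telescope: "(\<Sum>i\<le>N. coeff (char_poly A) i * (A ^\<^sub>m (k + i)) $$ (a, c)) =
      - (A ^\<^sub>m (k + N) * (A * D N)) $$ (a, c)" for N
  proof (induction N)
    case 0
    have "coeff (char_poly A) 0 \<cdot>\<^sub>m A ^\<^sub>m k = A ^\<^sub>m k * (coeff (char_poly A) 0 \<cdot>\<^sub>m 1\<^sub>m n)"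
      using pw[of k] mult_smult_distrib[of "A ^\<^sub>m k" n n "1\<^sub>m n" n] right_mult_one_mat[OF pw[of k]]
      by simp
    also have "\<dots> = - (A ^\<^sub>m k * (A * D 0))"
      unfolding eq0 using pw[of k] A D[of 0] by (intro eq_matI) auto
    finally have "coeff (char_poly A) 0 \<cdot>\<^sub>m A ^\<^sub>m k = - (A ^\<^sub>m k * (A * D 0))" .
    from arg_cong[OF this, of "\<lambda>M. M $$ (a, c)"] show ?case
      using ac pw[of k] A D[of 0] by (simp del: index_mult_mat(1))
  next
    case (Suc N)
    let ?X = "A ^\<^sub>m (k + N)"
    have XA: "A ^\<^sub>m (k + Suc N) = ?X * A" by simp
    have "coeff (char_poly A) (Suc N) \<cdot>\<^sub>m A ^\<^sub>m (k + Suc N)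
        = A ^\<^sub>m (k + Suc N) * (coeff (char_poly A) (Suc N) \<cdot>\<^sub>m 1\<^sub>m n)"
      using pw[of "k + Suc N"] mult_smult_distrib[of "A ^\<^sub>m (k + Suc N)" n n "1\<^sub>m n" n]
        right_mult_one_mat[OF pw[of "k + Suc N"]]
      by (simp del: pow_mat.simps add_Suc_right)
    also have "\<dots> = A ^\<^sub>m (k + Suc N) * D N - A ^\<^sub>m (k + Suc N) * (A * D (Suc N))"
      unfolding eqS by (rule mult_minus_distrib_mat[OF pw D]) (use A D in auto)
    \<comment> \<open>This term cancels the remainder left by the induction hypothesis.\<close>
    also have "A ^\<^sub>m (k + Suc N) * D N = ?X * (A * D N)"
      unfolding XA by (rule assoc_mult_mat[OF pw A D])
    finally have "coeff (char_poly A) (Suc N) \<cdot>\<^sub>m A ^\<^sub>m (k + Suc N) =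
      ?X * (A * D N) - A ^\<^sub>m (k + Suc N) * (A * D (Suc N))" .
    from arg_cong[OF this, of "\<lambda>M. M $$ (a, c)"] show ?case
      using ac pw[of "k + Suc N"] pw[of "k + N"] A D[of N] D[of "Suc N"] Suc.IH
      by (simp del: index_mult_mat(1) pow_mat.simps add_Suc_right)
  qed
  \<comment> \<open>\<open>N\<close> exceeds the degree of every entry of \<open>B\<close>, so
    \<open>D N\<close> vanishes. It also exceeds \<open>n\<close>, so cutting the sum back to
    \<open>n\<close> drops only zero coefficients.\<close>
  define N where "N = n + (\<Sum>a<n. \<Sum>c<n. Polynomial.degree (B $$ (a, c))) + 1"
  have "Polynomial.degree (B $$ (a, c)) < N" if "a < n" "c < n" for a c
  proof -
    have "Polynomial.degree (B $$ (a, c)) \<le> (\<Sum>c<n. Polynomial.degree (B $$ (a, c)))"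
      using that by (intro member_le_sum) auto
    also have "\<dots> \<le> (\<Sum>a<n. \<Sum>c<n. Polynomial.degree (B $$ (a, c)))"
      using that by (intro member_le_sum[of a _ "\<lambda>a. \<Sum>c<n. Polynomial.degree (B $$ (a, c))"]) auto
    finally show ?thesis by (simp add: N_def)
  qed
  then have "D N = 0\<^sub>m n n"
    by (intro eq_matI) (auto simp: D_def coeff_eq_0)
  then have "(\<Sum>i\<le>N. coeff (char_poly A) i * (A ^\<^sub>m (k + i)) $$ (a, c)) = 0"
    using telescope[of N] A pw[of "k + N"] ac by simp
  moreover have "(\<Sum>i\<le>N. coeff (char_poly A) i * (A ^\<^sub>m (k + i)) $$ (a, c)) =
      (\<Sum>i\<le>n. coeff (char_poly A) i * (A ^\<^sub>m (k + i)) $$ (a, c))"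
    using degree_monic_char_poly[OF A]
    by (intro sum.mono_neutral_right) (auto simp: N_def coeff_eq_0)
  ultimately show ?thesis by simp
qed

section \<open>The Vandermonde determinant\<close>

lemma det_vandermonde:
  fixes x :: "nat \<Rightarrow> 'a::comm_ring_1"
  shows "det (mat m m (\<lambda>(l, j). x j ^ (m - Suc l))) = (\<Prod>l<m. \<Prod>j\<in>{l<..<m}. x l - x j)"
proof -
  \<comment> \<open>The Newton basis: its values at the points form a lower triangular matrix, and its
    transition matrix to the monomials is upper unitriangular.\<close>
  define N where "N l = (\<Prod>k\<in>{l<..<m}. [:- x k, 1:])" for l
  have N: "Polynomial.degree (N l) = m - Suc l \<and> coeff (N l) (m - Suc l) = 1" for l
    unfolding N_def
    using degree_prod_sum_monic[of "{l<..<m}" "\<lambda>k. [:- x k, 1:]"] by (auto simp: image_iff)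
  let ?T = "mat m m (\<lambda>(l, i). coeff (N l) (m - Suc i))"
  let ?V = "mat m m (\<lambda>(l, j). x j ^ (m - Suc l))"
  let ?E = "mat m m (\<lambda>(l, j). poly (N l) (x j))"
  have "?E = ?T * ?V"
  proof (rule eq_matI)
    fix l j assume "l < dim_row (?T * ?V)" "j < dim_col (?T * ?V)"
    then have lj: "l < m" "j < m" by auto
    have "poly (N l) (x j) = (\<Sum>i<m. coeff (N l) i * x j ^ i)"
      unfolding poly_altdef
      by (rule sum.mono_neutral_left) (use lj N in \<open>auto simp: not_le coeff_eq_0\<close>)
    also have "\<dots> = (\<Sum>i<m. coeff (N l) (m - Suc i) * x j ^ (m - Suc i))"
      by (rule sum.nat_diff_reindex[symmetric])
    finally show "?E $$ (l, j) = (?T * ?V) $$ (l, j)"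
      using lj by (simp add: scalar_prod_def lessThan_atLeast0)
  qed auto
  then have "det ?E = det ?T * det ?V"
    by (simp add: det_mult[of _ m])
  moreover have "det ?T = 1"
  proof -
    have "upper_triangular ?T"
      using N by (auto simp: upper_triangular_def intro!: coeff_eq_0)
    then have "det ?T = prod_list (diag_mat ?T)"
      by (rule det_upper_triangular[of _ m]) simp
    also have "\<dots> = 1"
      using N by (simp add: prod_list_diag_prod)
    finally show ?thesis .
  qed
  moreover have "det ?E = (\<Prod>l<m. \<Prod>j\<in>{l<..<m}. x l - x j)"
  proof -
    \<comment> \<open>For \<open>j > l\<close> the factor of \<open>N l\<close> with
      \<open>k = j\<close> vanishes at \<open>x j\<close>.\<close>
    have "det ?E = prod_list (diag_mat ?E)"
      by (rule det_lower_triangular[of m]) (auto simp: N_def poly_prod intro!: prod_zero)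
    also have "\<dots> = (\<Prod>l<m. \<Prod>j\<in>{l<..<m}. x l - x j)"
      by (simp add: prod_list_diag_prod N_def poly_prod lessThan_atLeast0)
    finally show ?thesis .
  qed
  ultimately show ?thesis by simp
qed

section \<open>Reduction of powers modulo a monic polynomial\<close>

text \<open>\<open>power_rem m c n i\<close> is the coefficient of \<open>x\<^sup>i\<close> in the remainder of \<open>x\<^sup>n\<close> modulo the monic
  polynomial of degree \<open>m \<ge> 1\<close> with coefficients \<open>c\<close>; it is meaningful only for \<open>i < m\<close>. The explicit
  recursion makes it obvious that it commutes with ring homomorphisms.\<close>

primrec power_rem :: "nat \<Rightarrow> (nat \<Rightarrow> 'a::comm_ring_1) \<Rightarrow> nat \<Rightarrow> nat \<Rightarrow> 'a" where
  "power_rem m c 0 i = (if i = 0 then 1 else 0)"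
| "power_rem m c (Suc n) i =
    (if i = 0 then 0 else power_rem m c n (i - 1)) - power_rem m c n (m - 1) * c i"

lemma (in comm_ring_hom) hom_power_rem:
  "hom (power_rem m c n i) = power_rem m (\<lambda>i. hom (c i)) n i"
  by (induction n arbitrary: i) (auto simp: hom_distribs)

text \<open>A sequence obeying the recurrence cannot tell \<open>x^n\<close> from its remainder. A
  further factor \<open>x\<close> shifts the remainder by one place, and the overflow into
  \<open>x^m\<close> is rewritten by the recurrence, exactly as in the second equation of
  \<open>power_rem\<close>.\<close>

lemma recurrence_power_rem:
  fixes s :: "nat \<Rightarrow> 'a::comm_ring_1"
  assumes "m \<ge> 1" and monic: "c m = 1" and rec: "\<And>k. (\<Sum>i\<le>m. c i * s (k + i)) = 0"
  shows "s (k + n) = (\<Sum>i<m. power_rem m c n i * s (k + i))"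
proof (induction n arbitrary: k)
  case 0
  show ?case
    using \<open>m \<ge> 1\<close> by (simp add: if_distrib[of "\<lambda>x. x * _"] cong: if_cong)
next
  case (Suc n)
  obtain m' where m': "m = Suc m'" using \<open>m \<ge> 1\<close> by (cases m) auto
  have "s (k + m) = - (\<Sum>i<m. c i * s (k + i))"
    using rec[of k] monic by (simp add: lessThan_Suc_atMost[symmetric] add_eq_0_iff)
  then have top: "s (Suc k + m') = - (\<Sum>i<m. c i * s (k + i))"
    by (simp add: m')
  have "s (k + Suc n) = s (Suc k + n)" by simp
  also have "\<dots> = (\<Sum>i<m. power_rem m c n i * s (Suc k + i))" by (rule Suc.IH)
  also have "\<dots> = (\<Sum>i<m'. power_rem m c n i * s (k + Suc i)) + power_rem m c n m' * s (Suc k + m')"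
    by (simp add: m')
  \<comment> \<open>The sum gains a zero term at \<open>i = 0\<close>, to match the case distinction
    in \<open>power_rem\<close>.\<close>
  also have "(\<Sum>i<m'. power_rem m c n i * s (k + Suc i)) =
      (\<Sum>i<m. (if i = 0 then 0 else power_rem m c n (i - 1)) * s (k + i))"
    unfolding m' by (subst sum.lessThan_Suc_shift) simp
  also have "\<dots> + power_rem m c n m' * s (Suc k + m') =
      (\<Sum>i<m. power_rem m c (Suc n) i * s (k + i))"
    unfolding top m' by (simp add: algebra_simps sum_subtractf sum_distrib_left)
  finally show ?case .
qed

text \<open>This is \<open>det C\<close>. Coefficients and degree bounds are separate arguments,
  instead of polynomials, so that a ring homomorphism passes inside without any care for
  degrees.\<close>

definition reduction_det ::
  "nat \<Rightarrow> (nat \<Rightarrow> nat) \<Rightarrow> (nat \<Rightarrow> nat \<Rightarrow> 'a::comm_ring_1) \<Rightarrow> (nat \<Rightarrow> 'a) \<Rightarrow> 'a" where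
  "reduction_det m d a c =
    det (mat m m (\<lambda>(l, i). \<Sum>n\<le>d l. a l n * power_rem m c n (m - Suc i)))"

lemma (in comm_ring_hom) hom_reduction_det:
  "hom (reduction_det m d a c) = reduction_det m d (\<lambda>l n. hom (a l n)) (\<lambda>i. hom (c i))"
  unfolding reduction_det_def hom_det[symmetric]
  by (rule arg_cong[of _ _ det], rule eq_matI) (auto simp: hom_distribs hom_power_rem)

text \<open>Common source of both quotients: \<open>s j n\<close> will be the power of a root or a
  diagonal entry of a matrix power. Reducing each \<open>s j n\<close> to indices below
  \<open>m\<close> factors the matrix on the left.\<close>

lemma det_recurrence:
  fixes s :: "nat \<Rightarrow> nat \<Rightarrow> 'a::comm_ring_1"
  assumes "m \<ge> 1" "c m = 1" and rec: "\<And>j k. j < m \<Longrightarrow> (\<Sum>i\<le>m. c i * s j (k + i)) = 0"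
  shows "det (mat m m (\<lambda>(l, j). \<Sum>n\<le>d l. a l n * s j n)) =
    reduction_det m d a c * det (mat m m (\<lambda>(l, j). s j (m - Suc l)))"
proof -
  let ?C = "mat m m (\<lambda>(l, i). \<Sum>n\<le>d l. a l n * power_rem m c n (m - Suc i))"
  let ?V = "mat m m (\<lambda>(l, j). s j (m - Suc l))"
  let ?E = "mat m m (\<lambda>(l, j). \<Sum>n\<le>d l. a l n * s j n)"
  have "?E = ?C * ?V"
  proof (rule eq_matI)
    fix l j assume "l < dim_row (?C * ?V)" "j < dim_col (?C * ?V)"
    then have lj: "l < m" "j < m" by auto
    have "s j n = (\<Sum>i<m. power_rem m c n i * s j i)" for n
      using recurrence_power_rem[of m c "s j" 0 n] assms lj by simp
    \<comment> \<open>Descending indices match the row order \<open>m - Suc l\<close> of the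
      denominator.\<close>
    also have "(\<Sum>i<m. power_rem m c n i * s j i) =
        (\<Sum>i<m. power_rem m c n (m - Suc i) * s j (m - Suc i))" for n
      by (rule sum.nat_diff_reindex[symmetric])
    finally have s: "s j n = (\<Sum>i<m. power_rem m c n (m - Suc i) * s j (m - Suc i))" for n .
    have "?E $$ (l, j) = (\<Sum>n\<le>d l. a l n * (\<Sum>i<m. power_rem m c n (m - Suc i) * s j (m - Suc i)))"
      using lj by (simp add: s[symmetric])
    also have "\<dots> = (\<Sum>i<m. (\<Sum>n\<le>d l. a l n * power_rem m c n (m - Suc i)) * s j (m - Suc i))"
      unfolding sum_distrib_left sum_distrib_right mult.assoc by (rule sum.swap)
    finally show "?E $$ (l, j) = (?C * ?V) $$ (l, j)"
      using lj by (simp add: scalar_prod_def lessThan_atLeast0)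
  qed auto
  then show ?thesis
    by (simp add: det_mult[of _ m] reduction_det_def)
qed

section \<open>Determinants of polynomials at roots and on matrix diagonals\<close>

lemma vandermonde_neq_0_iff:
  fixes x :: "nat \<Rightarrow> 'a::idom"
  shows "(\<Prod>l<m. \<Prod>j\<in>{l<..<m}. x l - x j) \<noteq> 0 \<longleftrightarrow> inj_on x {..<m}"
proof
  assume *: "(\<Prod>l<m. \<Prod>j\<in>{l<..<m}. x l - x j) \<noteq> 0"
  show "inj_on x {..<m}"
    by (rule linorder_inj_onI) (use * in auto)
next
  assume "inj_on x {..<m}"
  then show "(\<Prod>l<m. \<Prod>j\<in>{l<..<m}. x l - x j) \<noteq> 0"
    by (auto dest: inj_onD)
qed

text \<open>As \<open>f\<close> reflects zero, the leading coefficient survives and the degree of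
  \<open>p\<close> can remain the summation bound.\<close>

lemma poly_map_poly_altdef:
  fixes f :: "'a::comm_ring_1 \<Rightarrow> 'b::comm_ring_1"
  assumes "f 0 = 0" "\<And>y. f y = 0 \<Longrightarrow> y = 0"
  shows "poly (map_poly f p) x = (\<Sum>n\<le>Polynomial.degree p. f (coeff p n) * x ^ n)"
proof -
  have "Polynomial.degree (map_poly f p) = Polynomial.degree p"
    using assms by (cases "p = 0") (auto intro!: Polynomial.degree_map_poly)
  then show ?thesis
    using assms(1) by (simp add: poly_altdef coeff_map_poly)
qed

lemma poly_mat_map_poly:
  fixes f :: "'a::comm_ring_1 \<Rightarrow> 'b::comm_ring_1"
  assumes "f 0 = 0" "\<And>y. f y = 0 \<Longrightarrow> y = 0" "A \<in> carrier_mat m m" "i < m" "j < m"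
  shows "poly_mat (map_poly f p) A $$ (i, j) =
    (\<Sum>n\<le>Polynomial.degree p. f (coeff p n) * (A ^\<^sub>m n) $$ (i, j))"
proof -
  have "Polynomial.degree (map_poly f p) = Polynomial.degree p"
    using assms by (cases "p = 0") (auto intro!: Polynomial.degree_map_poly)
  then show ?thesis
    using assms by (simp add: poly_mat_def coeff_map_poly)
qed

lemma monic_linear_prod:
  fixes x :: "nat \<Rightarrow> 'a::idom"
  shows "Polynomial.degree (\<Prod>j<m. [:- x j, 1:]) = m" "coeff (\<Prod>j<m. [:- x j, 1:]) m = 1"
  using degree_prod_sum_monic[of "{..<m}" "\<lambda>j. [:- x j, 1:]"] by (auto simp: image_iff)

lemma det_poly_roots:
  fixes x :: "nat \<Rightarrow> 'a::idom"
  assumes "m \<ge> 1"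
  shows "det (mat m m (\<lambda>(l, j). \<Sum>n\<le>d l. a l n * x j ^ n)) =
    reduction_det m d a (coeff (\<Prod>j<m. [:- x j, 1:])) * (\<Prod>l<m. \<Prod>j\<in>{l<..<m}. x l - x j)"
proof -
  let ?p = "\<Prod>j<m. [:- x j, 1:]"
  have "(\<Sum>i\<le>m. coeff ?p i * x j ^ (k + i)) = 0" if "j < m" for j k
  proof -
    have "poly ?p (x j) = 0"
      using that by (auto simp: poly_prod)
    then have "x j ^ k * (\<Sum>i\<le>m. coeff ?p i * x j ^ i) = 0"
      by (simp add: poly_altdef monic_linear_prod)
    then show ?thesis
      by (simp only: sum_distrib_left power_add ac_simps)
  qed
  then show ?thesis
    using det_recurrence[of m "coeff ?p" "\<lambda>j n. x j ^ n" a d] assms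
    by (simp add: monic_linear_prod det_vandermonde)
qed

lemma det_poly_diag:
  fixes A :: "'a::comm_ring_1 mat"
  assumes "m \<ge> 1" "A \<in> carrier_mat m m"
  shows "det (mat m m (\<lambda>(l, j). \<Sum>n\<le>d l. a l n * (A ^\<^sub>m n) $$ (j, j))) =
    reduction_det m d a (coeff (char_poly A)) * det (mat m m (\<lambda>(l, j). (A ^\<^sub>m (m - Suc l)) $$ (j, j)))"
  using det_recurrence[of m "coeff (char_poly A)" "\<lambda>j n. (A ^\<^sub>m n) $$ (j, j)" a d] assms
    cayley_hamilton_entry[OF assms(2)] degree_monic_char_poly[OF assms(2)]
  by simp

section \<open>The generic matrix and its specialisations\<close>

text \<open>A polynomial version of \<open>generic_mat\<close>: \<open>meval\<close> specialises
  polynomials, not fractions.\<close>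

definition generic_cmat :: "nat \<Rightarrow> cmpoly mat" where
  "generic_cmat m = mat m m (\<lambda>(i, j). mvar (prod_encode (i, j)))"

lemma generic_cmat_carrier [simp]: "generic_cmat m \<in> carrier_mat m m"
  by (simp add: generic_cmat_def)

lemma generic_cmat_dim [simp]: "dim_row (generic_cmat m) = m" "dim_col (generic_cmat m) = m"
  by (simp_all add: generic_cmat_def)

lemma generic_mat_eq: "generic_mat m = map_mat to_fract (generic_cmat m)"
  by (rule eq_matI) (auto simp: generic_mat_def generic_cmat_def)

lemma map_mat_meval_generic:
  assumes "A \<in> carrier_mat m m"
  shows "map_mat (meval (\<lambda>v. A $$ prod_decode v)) (generic_cmat m) = A"
  by (rule eq_matI) (use assms in \<open>auto simp: generic_cmat_def\<close>)

lemma det_generic_diag_neq_0: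
  "det (mat m m (\<lambda>(l, j). (generic_cmat m ^\<^sub>m (m - Suc l)) $$ (j, j))) \<noteq> 0" (is "det ?M \<noteq> 0")
proof
  assume "det ?M = 0"
  \<comment> \<open>Specialised to a diagonal matrix, the determinant is a Vandermonde determinant.\<close>
  define D :: "complex mat" where "D = mat_diag m of_nat"
  define x where "x v = D $$ prod_decode v" for v
  interpret comm_ring_hom "meval x" by (rule comm_ring_hom_meval)
  have D: "D \<in> carrier_mat m m"
    by (simp add: D_def)
  have pow: "D ^\<^sub>m k = mat_diag m (\<lambda>j. of_nat j ^ k)" for k
    by (induction k) (auto simp: D_def mat_diag_diag power_commutes mat_diag_dim[THEN carrier_matD(1)])
  have "map_mat (meval x) (generic_cmat m ^\<^sub>m k) = D ^\<^sub>m k" for k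
    using map_mat_meval_generic[OF D, folded x_def[abs_def]]
    by (simp add: mat_hom_pow[OF generic_cmat_carrier])
  then have "meval x ((generic_cmat m ^\<^sub>m k) $$ (j, j)) = (D ^\<^sub>m k) $$ (j, j)" if "j < m" for j k
    using that index_map_mat(1)[of j "generic_cmat m ^\<^sub>m k" j "meval x"] by simp
  then have "map_mat (meval x) ?M = mat m m (\<lambda>(l, j). of_nat j ^ (m - Suc l))"
    by (intro eq_matI) (auto simp: pow mat_diag_def)
  then have "det (mat m m (\<lambda>(l, j). (of_nat j :: complex) ^ (m - Suc l))) = 0"
    using hom_det[of ?M] \<open>det ?M = 0\<close> by simp
  then show False
    using vandermonde_neq_0_iff[of "of_nat :: nat \<Rightarrow> complex" m]
    by (simp add: det_vandermonde inj_on_def)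
qed

section \<open>Hermitian Jacobi polynomials as reduction determinants\<close>

text \<open>\<open>det_poly_roots\<close> in the polynomial ring exhibits a quotient. The variables
  are distinct, so the Vandermonde product is nonzero and can be cancelled, which makes the quotient
  unique.\<close>

lemma sym_jacobi_eq:
  assumes "m \<ge> 1"
  shows "sym_jacobi m P \<tau> =
    reduction_det m (\<lambda>l. Polynomial.degree (P (\<tau> ! l + (m - Suc l))))
      (\<lambda>l n. mconst (complex_of_real (coeff (P (\<tau> ! l + (m - Suc l))) n)))
      (coeff (\<Prod>j<m. [:- mvar j, 1:]))" (is "_ = ?S")
proof -
  have inj: "mconst (complex_of_real c) = 0 \<Longrightarrow> c = 0" for c
    using meval_mconst[of undefined "complex_of_real c"] by simp
  have "(\<Prod>l<m. \<Prod>j\<in>{l<..<m}. mvar l - mvar j) \<noteq> 0"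
    by (subst vandermonde_neq_0_iff) (simp add: inj_on_def mvar_eq_iff)
  moreover have "det (mat m m (\<lambda>(l, j).
       poly (map_poly (\<lambda>c. mconst (complex_of_real c)) (P (\<tau> ! l + (m - Suc l)))) (mvar j))) =
      ?S * (\<Prod>l<m. \<Prod>j\<in>{l<..<m}. mvar l - mvar j)"
    unfolding det_poly_roots[OF assms, symmetric]
    using inj by (subst poly_map_poly_altdef) (auto simp: mconst_def)
  ultimately show ?thesis
    unfolding sym_jacobi_def by (intro the_equality) auto
qed

text \<open>Evaluation at the eigenvalues sends the product of the \<open>[:- mvar j, 1:]\<close> to
  \<open>char_poly A\<close>, so their unspecified order disappears.\<close>

lemma hermitian_jacobi_eq:
  assumes "m \<ge> 1" and A: "A \<in> carrier_mat m m"
  shows "hermitian_jacobi m P \<tau> A =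
    reduction_det m (\<lambda>l. Polynomial.degree (P (\<tau> ! l + (m - Suc l))))
      (\<lambda>l n. complex_of_real (coeff (P (\<tau> ! l + (m - Suc l))) n)) (coeff (char_poly A))"
proof -
  let ?es = "eigenvalue_list A"
  interpret comm_ring_hom "meval (\<lambda>j. ?es ! j)" by (rule comm_ring_hom_meval)
  interpret mp: map_poly_comm_ring_hom "meval (\<lambda>j. ?es ! j)" ..
  \<comment> \<open>The characteristic polynomial splits over the complex numbers, so the choice in
    \<open>eigenvalue_list\<close> succeeds.\<close>
  have es: "char_poly A = (\<Prod>e\<leftarrow>?es. [:- e, 1:])"
    unfolding eigenvalue_list_def using char_poly_factorized[OF A] by (metis (mono_tags, lifting) someI)
  then have len: "length ?es = m"
    using degree_linear_factors[of uminus ?es] degree_monic_char_poly[OF A] by simp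
  have "map_poly (meval (\<lambda>j. ?es ! j)) (\<Prod>j<m. [:- mvar j, 1:]) = (\<Prod>j<m. [:- (?es ! j), 1:])"
    by (simp add: mp.hom_prod hom_distribs)
  also have "\<dots> = char_poly A"
    by (subst es) (simp add: prod.list_conv_set_nth len lessThan_atLeast0)
  finally have "meval (\<lambda>j. ?es ! j) (coeff (\<Prod>j<m. [:- mvar j, 1:]) i) = coeff (char_poly A) i" for i
    by (metis coeff_map_poly_hom)
  then show ?thesis
    by (simp add: hermitian_jacobi_def sym_jacobi_eq[OF assms(1)] hom_reduction_det)
qed

text \<open>Specialisation is a ring homomorphism, hence commutes with \<open>char_poly\<close> and
  \<open>reduction_det\<close>.\<close>

lemma eval_coeffs_reduction_det:
  assumes "A \<in> carrier_mat m m"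
  shows "eval_coeffs A (reduction_det m d (\<lambda>l n. mconst (a l n)) (coeff (char_poly (generic_cmat m)))) =
    reduction_det m d a (coeff (char_poly A))"
proof -
  let ?x = "\<lambda>v. A $$ prod_decode v"
  interpret comm_ring_hom "meval ?x" by (rule comm_ring_hom_meval)
  have "char_poly A = map_poly (meval ?x) (char_poly (generic_cmat m))"
    using char_poly_hom[of "generic_cmat m" m] map_mat_meval_generic[OF assms] by simp
  then have "coeff (char_poly A) = (\<lambda>i. meval ?x (coeff (char_poly (generic_cmat m)) i))"
    by (simp add: fun_eq_iff coeff_map_poly)
  then show ?thesis
    by (simp add: eval_coeffs_def hom_reduction_det)
qed

section \<open>The generic and the pointwise identity\<close>

theorem proposition1p12:
  fixes m :: nat and \<kappa>\<^sub>1 \<kappa>\<^sub>2 :: real and P :: "nat \<Rightarrow> real poly" and \<tau> :: "nat list"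
  assumes "m \<ge> 1"
    and "\<kappa>\<^sub>1 > real m / 2 - 1" and "\<kappa>\<^sub>2 > real m / 2 - 1"
    and "\<And>r. jacobi_poly (\<kappa>\<^sub>1 - real m / 2) (\<kappa>\<^sub>2 - real m / 2) r (P r)"
    and "is_partition m \<tau>"
  shows
    "(\<exists>Q. (\<forall>\<Lambda>\<in>carrier_mat m m. hermitian_mat \<Lambda> \<longrightarrow>
             hermitian_jacobi m P \<tau> \<Lambda> = eval_coeffs \<Lambda> Q) \<and>
         det (mat m m (\<lambda>(l, j). (generic_mat m ^\<^sub>m (m - Suc l)) $$ (j, j))) \<noteq> 0 \<and>
         to_fract Q =
           det (mat m m (\<lambda>(l, j).
             poly_mat (map_poly fract_of_real (P (\<tau> ! l + (m - Suc l)))) (generic_mat m) $$ (j, j))) /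
           det (mat m m (\<lambda>(l, j). (generic_mat m ^\<^sub>m (m - Suc l)) $$ (j, j)))) \<and>
     (\<forall>\<Lambda>\<in>carrier_mat m m. hermitian_mat \<Lambda> \<longrightarrow>
       det (mat m m (\<lambda>(l, j). (\<Lambda> ^\<^sub>m (m - Suc l)) $$ (j, j))) \<noteq> 0 \<longrightarrow>
       hermitian_jacobi m P \<tau> \<Lambda> =
         det (mat m m (\<lambda>(l, j).
           poly_mat (map_poly complex_of_real (P (\<tau> ! l + (m - Suc l)))) \<Lambda> $$ (j, j))) /
         det (mat m m (\<lambda>(l, j). (\<Lambda> ^\<^sub>m (m - Suc l)) $$ (j, j))))"
proof (intro conjI ballI impI exI)
  define a where "a l = coeff (P (\<tau> ! l + (m - Suc l)))" for l
  define d where "d l = Polynomial.degree (P (\<tau> ! l + (m - Suc l)))" for l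
  \<comment> \<open>The witness is \<open>det C\<close> for the characteristic polynomial of the
    generic matrix, formed before passing to fractions.\<close>
  define Q where "Q = reduction_det m d (\<lambda>l n. mconst (complex_of_real (a l n)))
    (coeff (char_poly (generic_cmat m)))"
  interpret fr: comm_ring_hom "to_fract :: cmpoly \<Rightarrow> _" by (rule comm_ring_hom_to_fract)
  have jacobi: "hermitian_jacobi m P \<tau> \<Lambda> =
      reduction_det m d (\<lambda>l n. complex_of_real (a l n)) (coeff (char_poly \<Lambda>))"
    if "\<Lambda> \<in> carrier_mat m m" for \<Lambda>
    using hermitian_jacobi_eq[OF \<open>m \<ge> 1\<close> that, of P \<tau>] by (simp add: a_def d_def[abs_def])
  show "hermitian_jacobi m P \<tau> \<Lambda> = eval_coeffs \<Lambda> Q" if "\<Lambda> \<in> carrier_mat m m" for \<Lambda>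
    by (simp add: Q_def jacobi eval_coeffs_reduction_det that)
  let ?M = "mat m m (\<lambda>(l, j). (generic_cmat m ^\<^sub>m (m - Suc l)) $$ (j, j))"
  let ?D = "det (mat m m (\<lambda>(l, j). (generic_mat m ^\<^sub>m (m - Suc l)) $$ (j, j)))"
  have G: "generic_mat m \<in> carrier_mat m m"
    by (simp add: generic_mat_eq)
  have pow: "generic_mat m ^\<^sub>m k = map_mat to_fract (generic_cmat m ^\<^sub>m k)" for k
    unfolding generic_mat_eq by (rule fr.mat_hom_pow[OF generic_cmat_carrier, symmetric])
  have "?D = det (map_mat to_fract ?M)"
    by (rule arg_cong[of _ _ det], rule eq_matI) (auto simp: pow)
  then show D: "?D \<noteq> 0"
    using det_generic_diag_neq_0[of m] by simp
  have fract_of_real_0: "fract_of_real 0 = 0"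
    by (simp add: fract_of_real_def mconst_def)
  have inj: "fract_of_real c = 0 \<Longrightarrow> c = 0" for c
    using meval_mconst[of undefined "complex_of_real c"] by (simp add: fract_of_real_def)
  have "det (mat m m (\<lambda>(l, j).
      poly_mat (map_poly fract_of_real (P (\<tau> ! l + (m - Suc l)))) (generic_mat m) $$ (j, j))) =
    det (mat m m (\<lambda>(l, j). \<Sum>n\<le>d l. fract_of_real (a l n) * (generic_mat m ^\<^sub>m n) $$ (j, j)))"
    by (rule arg_cong[of _ _ det], rule eq_matI)
      (use inj in \<open>auto simp: poly_mat_map_poly[OF _ _ G] fract_of_real_0 a_def d_def\<close>)
  also have "\<dots> = reduction_det m d (\<lambda>l n. fract_of_real (a l n)) (coeff (char_poly (generic_mat m))) * ?D"
    by (rule det_poly_diag[OF \<open>m \<ge> 1\<close> G])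
  also have "coeff (char_poly (generic_mat m)) = (\<lambda>i. to_fract (coeff (char_poly (generic_cmat m)) i))"
    by (simp add: fun_eq_iff generic_mat_eq fr.char_poly_hom[of _ m] coeff_map_poly)
  also have "reduction_det m d (\<lambda>l n. fract_of_real (a l n)) \<dots> = to_fract Q"
    by (simp add: Q_def fr.hom_reduction_det fract_of_real_def)
  finally show "to_fract Q = det (mat m m (\<lambda>(l, j).
      poly_mat (map_poly fract_of_real (P (\<tau> ! l + (m - Suc l)))) (generic_mat m) $$ (j, j))) / ?D"
    using D by simp
  \<comment> \<open>For the pointwise identity \<open>det_poly_diag\<close> is applied to the
    complex matrix itself, so no fraction has to be evaluated.\<close>
  fix \<Lambda> :: "complex mat"
  let ?D = "det (mat m m (\<lambda>(l, j). (\<Lambda> ^\<^sub>m (m - Suc l)) $$ (j, j)))"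
  assume \<Lambda>: "\<Lambda> \<in> carrier_mat m m" and D: "?D \<noteq> 0"
  have diag: "poly_mat (map_poly complex_of_real p) \<Lambda> $$ (j, j) =
      (\<Sum>n\<le>Polynomial.degree p. complex_of_real (coeff p n) * (\<Lambda> ^\<^sub>m n) $$ (j, j))"
    if "j < m" for p j
    by (rule poly_mat_map_poly[OF _ _ \<Lambda> that that]) simp_all
  have "det (mat m m (\<lambda>(l, j).
      poly_mat (map_poly complex_of_real (P (\<tau> ! l + (m - Suc l)))) \<Lambda> $$ (j, j))) =
    det (mat m m (\<lambda>(l, j). \<Sum>n\<le>d l. complex_of_real (a l n) * (\<Lambda> ^\<^sub>m n) $$ (j, j)))"
    by (rule arg_cong[of _ _ det], rule eq_matI) (auto simp: diag a_def d_def)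
  also have "\<dots> = hermitian_jacobi m P \<tau> \<Lambda> * ?D"
    by (simp add: det_poly_diag[OF \<open>m \<ge> 1\<close> \<Lambda>] jacobi \<Lambda>)
  finally show "hermitian_jacobi m P \<tau> \<Lambda> = det (mat m m (\<lambda>(l, j).
      poly_mat (map_poly complex_of_real (P (\<tau> ! l + (m - Suc l)))) \<Lambda> $$ (j, j))) / ?D"
    using D by simp
qed

end
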